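(* For every $n\ge 5$, the cycle graph $C_n$ on $n$ vertices belongs to $\mathcal{G}_2$; that is, there exist $2$-uniform words $w,v$ over the vertex set of $C_n$, each containing every vertex, such that $C_n=G(w,v)$.
   Context: For a word $w$, $\mathrm{alph}(w)$ is the set of letters occurring in $w$ and $|w|_a$ the number of occurrences of $a$; $w$ is $k$-uniform if $|w|_a=k$ for all $a\in\mathrm{alph}(w)$. For letters $a,b$, $\pi_{a,b}$ is the monoid morphism on words with $a\mapsto a$, $b\mapsto b$ and all other letters mapped to the empty word. For words $w,v$ with $\mathrm{alph}(w)=\mathrm{alph}(v)=A$, $G(w,v)$ is the undirected simple graph on vertex set $A$ in which distinct $a,b$ are adjacent iff $\pi_{a,b}(w)=\pi_{a,b}(v)$. For $k\in\mathbb{N}$, $\mathcal{G}_k$ is the set of graphs $G$ for which there exist $k$-uniform words $w,v\in V(G)^\ast$ with $G=G(w,v)$. *)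

theory Defs
  imports "Graph_Theory.Pair_Digraph"
begin

text \<open>Words are lists; \<open>alph(w)\<close> is \<^term>\<open>set w\<close> and the number of occurrences of \<open>a\<close> in \<open>w\<close> is
  \<^term>\<open>count_list w a\<close>. Undirected simple graphs are loop-free symmetric pair digraphs
  (locale \<^locale>\<open>pair_graph\<close>), so that equality of graphs is equality of vertex and edge sets.\<close>

definition k_uniform :: "nat \<Rightarrow> 'a list \<Rightarrow> bool" where
  "k_uniform k w \<longleftrightarrow> (\<forall>a\<in>set w. count_list w a = k)"

definition letter_proj :: "'a \<Rightarrow> 'a \<Rightarrow> 'a list \<Rightarrow> 'a list" where
  "letter_proj a b w = filter (\<lambda>c. c = a \<or> c = b) w"

lemma letter_proj_Nil: "letter_proj a b [] = []"
  by (simp add: letter_proj_def)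

lemma letter_proj_append: "letter_proj a b (w @ v) = letter_proj a b w @ letter_proj a b v"
  by (simp add: letter_proj_def)

lemma letter_proj_letter: "letter_proj a b [c] = (if c = a \<or> c = b then [c] else [])"
  by (simp add: letter_proj_def)

text \<open>Only meaningful for words with the same alphabet.\<close>

definition word_graph :: "'a list \<Rightarrow> 'a list \<Rightarrow> 'a pair_pre_digraph" where
  "word_graph w v = \<lparr> pverts = set w,
     parcs = {(a, b). a \<in> set w \<and> b \<in> set w \<and> a \<noteq> b \<and> letter_proj a b w = letter_proj a b v} \<rparr>"

lemma letter_proj_commute: "letter_proj a b = letter_proj b a"
  unfolding letter_proj_def by (intro ext filter_cong) auto

lemma pair_graph_word_graph: "pair_graph (word_graph w v)"
proof
  show "finite (parcs (word_graph w v))"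
    by (rule finite_subset[of _ "set w \<times> set w"]) (auto simp: word_graph_def)
  show "symmetric (with_proj (word_graph w v))"
    unfolding symmetric_def by (auto simp: word_graph_def letter_proj_commute intro!: symI)
qed (auto simp: word_graph_def)

definition word_graph_class :: "nat \<Rightarrow> 'a pair_pre_digraph set" where
  "word_graph_class k = {G. \<exists>w\<in>lists (pverts G). \<exists>v\<in>lists (pverts G).
     k_uniform k w \<and> k_uniform k v \<and> set w = set v \<and> G = word_graph w v}"

definition cycle_graph :: "nat \<Rightarrow> nat pair_pre_digraph" where
  "cycle_graph n = \<lparr> pverts = {..<n},
     parcs = {(i, j). i < n \<and> j < n \<and> (j = Suc i mod n \<or> i = Suc j mod n)} \<rparr>"

lemma pair_graph_cycle_graph:
  assumes "n \<ge> 3"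
  shows "pair_graph (cycle_graph n)"
proof
  show "finite (parcs (cycle_graph n))"
    by (rule finite_subset[of _ "{..<n} \<times> {..<n}"]) (auto simp: cycle_graph_def)
  show "symmetric (with_proj (cycle_graph n))"
    unfolding symmetric_def by (auto simp: cycle_graph_def intro!: symI)
  show "fst e \<noteq> snd e" if "e \<in> parcs (cycle_graph n)" for e
    using that assms by (auto simp: cycle_graph_def mod_Suc split: if_splits)
qed (auto simp: cycle_graph_def)

end

theory Submission
  imports Defs
begin

text \<open>A product of two linear orders is a 2-uniform word, so for \<open>w = p\<^sub>1 p\<^sub>2\<close> and \<open>v = q\<^sub>1 q\<^sub>2\<close> two
  letters are adjacent iff \<open>p\<^sub>1\<close>, \<open>q\<^sub>1\<close> order them alike and \<open>p\<^sub>2\<close>, \<open>q\<^sub>2\<close> do as well. Hence it suffices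
  to write the cycle as the intersection of two permutation graphs. The first one is the path
  \<open>1, \<dots>, n - 1\<close> together with the universal vertex \<open>0\<close>, where \<open>p\<^sub>1 = 0 2 1 4 3 6 5 \<dots>\<close> and
  \<open>q\<^sub>1 = 0 \<dots> 6 7 4 5 2 3 1\<close>; the second one is the complete graph on \<open>1, \<dots>, n - 1\<close> with \<open>0\<close>
  joined to \<open>1\<close> and \<open>n - 1\<close> only, where \<open>p\<^sub>2 = 1 (n - 1) 2 3 \<dots> (n - 2) 0\<close> and
  \<open>q\<^sub>2 = 1 (n - 1) 0 2 3 \<dots> (n - 2)\<close>.\<close>

text \<open>Stable sorting commutes with \<open>filter\<close>, so a tie keeps the smaller letter
  first; hence \<open>\<le>\<close>.\<close>

lemma letter_proj_sort_key_upt: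
  assumes "a < b" "b < n"
  shows "letter_proj a b (sort_key f [0..<n]) = (if f a \<le> f b then [a, b] else [b, a])"
proof -
  have "[0..<n] = [0..<a] @ a # [Suc a..<b] @ b # [Suc b..<n]"
    using assms upt_add_eq_append[of 0 a "n - a"] upt_add_eq_append[of "Suc a" b "n - b"]
    by (simp add: upt_conv_Cons)
  then have "filter (\<lambda>c. c = a \<or> c = b) [0..<n] = [a, b]"
    using assms by simp
  then show ?thesis
    by (simp add: letter_proj_def filter_sort)
qed

lemma k_uniform_sort_key_upt_append:
  "k_uniform 2 (sort_key f [0..<n] @ sort_key g [0..<n])"
proof -
  have "count (mset [0..<n]) a = (if a < n then 1 else 0)" for a
    using distinct_count_atmost_1[of "[0..<n]"] by simp
  then have "count_list (sort_key f [0..<n]) a = (if a < n then 1 else 0)"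
    "count_list (sort_key g [0..<n]) a = (if a < n then 1 else 0)" for a
    by (simp_all flip: count_mset del: mset_upt)
  then show ?thesis
    by (simp add: k_uniform_def)
qed

text \<open>All four halves project to words of length two, so the equation splits in the
  middle.\<close>

lemma letter_proj_sort_key_append_eq_iff:
  assumes "a < b" "b < n"
  shows "letter_proj a b (sort_key f\<^sub>1 [0..<n] @ sort_key f\<^sub>2 [0..<n])
       = letter_proj a b (sort_key g\<^sub>1 [0..<n] @ sort_key g\<^sub>2 [0..<n])
     \<longleftrightarrow> (f\<^sub>1 a \<le> f\<^sub>1 b \<longleftrightarrow> g\<^sub>1 a \<le> g\<^sub>1 b) \<and> (f\<^sub>2 a \<le> f\<^sub>2 b \<longleftrightarrow> g\<^sub>2 a \<le> g\<^sub>2 b)"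
  using assms by (simp add: letter_proj_append letter_proj_sort_key_upt)

theorem theorem7:
  fixes n :: nat
  assumes "n \<ge> 5"
  shows "cycle_graph n \<in> word_graph_class 2"
proof -
  \<comment> \<open>Ties are broken by the usual order, as sorting is stable.\<close>
  define f\<^sub>1 where "f\<^sub>1 i = (if even i then i - 2 else i)" for i :: nat
  define g\<^sub>1 where "g\<^sub>1 i = (if i = 0 then 0 else if even i then n - i else n - i + 2)" for i :: nat
  define f\<^sub>2 where "f\<^sub>2 i = (if i = 1 \<or> i = n - 1 then 0 else if i = 0 then 2 else 1 :: nat)" for i
  define g\<^sub>2 where "g\<^sub>2 i = (if i = 1 \<or> i = n - 1 then 0 else 1 :: nat)" for i
  define w where "w = sort_key f\<^sub>1 [0..<n] @ sort_key f\<^sub>2 [0..<n]"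
  define v where "v = sort_key g\<^sub>1 [0..<n] @ sort_key g\<^sub>2 [0..<n]"
  have sets: "set w = {..<n}" "set v = {..<n}"
    by (auto simp: w_def v_def)
  \<comment> \<open>For \<open>0 < a\<close>: if \<open>b\<close> is at least \<open>a + 2\<close>,
    then \<open>f\<^sub>1\<close> keeps the order and \<open>g\<^sub>1\<close> reverses it; if
    \<open>b = a + 1\<close>, both keep it for even \<open>a\<close> and reverse it for odd
    \<open>a\<close>.\<close>
  have path: "(f\<^sub>1 a \<le> f\<^sub>1 b \<longleftrightarrow> g\<^sub>1 a \<le> g\<^sub>1 b) \<longleftrightarrow> a = 0 \<or> b = Suc a" if "a < b" "b < n" for a b
  proof (cases "a = 0")
    case True
    then show ?thesis by (simp add: f\<^sub>1_def g\<^sub>1_def)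
  next
    case False
    then show ?thesis
      using that unfolding f\<^sub>1_def g\<^sub>1_def by (cases "even a"; cases "even b"; auto elim!: evenE oddE; presburger)
  qed
  \<comment> \<open>The keys differ only at \<open>0\<close>, which comes last in one order and
    right after \<open>1\<close> and \<open>n - 1\<close> in the other.\<close>
  have star: "(f\<^sub>2 a \<le> f\<^sub>2 b \<longleftrightarrow> g\<^sub>2 a \<le> g\<^sub>2 b) \<longleftrightarrow> a \<noteq> 0 \<or> b = 1 \<or> b = n - 1"
    if "a < b" "b < n" for a b
    using that assms by (auto simp: f\<^sub>2_def g\<^sub>2_def)
  have adj_less: "letter_proj a b w = letter_proj a b v \<longleftrightarrow> b = Suc a mod n \<or> a = Suc b mod n"
    if "a < b" "b < n" for a b
    unfolding w_def v_def letter_proj_sort_key_append_eq_iff[OF that] path[OF that] star[OF that]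
    using that assms by (auto simp: mod_Suc)
  have adj: "a \<noteq> b \<and> letter_proj a b w = letter_proj a b v \<longleftrightarrow> b = Suc a mod n \<or> a = Suc b mod n"
    if "a < n" "b < n" for a b
  proof (cases a b rule: linorder_cases)
    case less
    then show ?thesis using adj_less that by simp
  next
    case equal
    then show ?thesis using that assms by (auto simp: mod_Suc)
  next
    case greater
    then show ?thesis using adj_less[of b a] that by (auto simp: letter_proj_commute[of a b])
  qed
  have "cycle_graph n = word_graph w v"
    unfolding cycle_graph_def word_graph_def sets using adj by auto
  moreover have "k_uniform 2 w" "k_uniform 2 v"
    unfolding w_def v_def by (rule k_uniform_sort_key_upt_append)+
  moreover have "pverts (cycle_graph n) = {..<n}"
    by (simp add: cycle_graph_def)
  ultimately show ?thesis
    unfolding word_graph_class_def mem_Collect_eq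
    by (intro bexI[of _ w] bexI[of _ v] conjI)
      (simp_all only: sets lists_eq_set mem_Collect_eq subset_refl)
qed

end
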